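(* Let $F$ be a $\phi\sigma$-field containing the field $\mathbb C(z)$ with $$\phi(z)=a_1z+a_2,\quad \sigma(z)=b_1z+b_2,\quad a_1,a_2,b_1,b_2\in\mathbb C,\quad a_1b_1\ne0,\quad \phi\sigma=\sigma\phi,\quad \phi^n\ne\mathrm{id}\ \text{ on }\mathbb C(z)\text{ for all integers }n\ge1,$$ where $\phi$ and $\sigma$ are the identity on $\mathbb C$, and let $\mathbf k:=F^\phi$. Let $0\ne f\in F$ and $0\ne a\in\mathbb C(z)$ be such that $f$ is a solution of $\phi(y)=ay$. Then $f$ is $\sigma$-algebraically dependent over the field $\mathbf k(z)$ if and only if $$\varphi(a)=\phi(b)/b$$ for some $0\ne b\in\mathbb C(z)$ and some $1\ne\varphi(x)=x^{n_0}\sigma(x)^{n_1}\cdots\sigma^{t-1}(x)^{n_{t-1}}$.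
   Context: A $\phi\sigma$-field is a field equipped with two commuting endomorphisms $\phi$ and $\sigma$. $F^\phi=\{r\in F\mid \phi(r)=r\}$. An element $f\in F$ is $\sigma$-algebraically dependent over a $\sigma$-subfield $E\subset F$ if $f,\sigma(f),\sigma^2(f),\dots$ are algebraically dependent over $E$, i.e. some nonzero polynomial over $E$ in finitely many of the $\sigma^i(f)$ vanishes. The functions $\varphi$ are multiplicative: $t\ge1$ and $n_0,\dots,n_{t-1}\in\mathbb Z$; $\varphi\ne1$ means that not all $n_i$ are zero; and $\varphi(a)=\prod_i\sigma^i(a)^{n_i}$. *)

theory Defs
  imports
    Complex_Main
    "HOL-Library.Poly_Mapping"
    "HOL-Computational_Algebra.Polynomial"
    "HOL-Computational_Algebra.Fraction_Field"
begin

locale field_hom =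
  fixes h :: "'a::field \<Rightarrow> 'b::field"
  assumes hom_one: "h 1 = 1"
    and hom_add: "h (x + y) = h x + h y"
    and hom_mult: "h (x * y) = h x * h y"

locale phi_sigma_field =
  phi: field_hom \<phi> + sigma: field_hom \<sigma>
  for \<phi> \<sigma> :: "'a::field \<Rightarrow> 'a" +
  assumes phi_sigma_commute: "\<phi> (\<sigma> x) = \<sigma> (\<phi> x)"

definition fixed_field :: "('a::field \<Rightarrow> 'a) \<Rightarrow> 'a set" where
  "fixed_field h = {r. h r = r}"

definition is_subfield :: "'a::field set \<Rightarrow> bool" where
  "is_subfield K \<longleftrightarrow> 0 \<in> K \<and> 1 \<in> K \<and>
     (\<forall>x\<in>K. \<forall>y\<in>K. x + y \<in> K \<and> x * y \<in> K) \<and>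
     (\<forall>x\<in>K. - x \<in> K \<and> inverse x \<in> K)"

definition adjoin :: "'a::field set \<Rightarrow> 'a \<Rightarrow> 'a set" where
  "adjoin K x = \<Inter>{L. is_subfield L \<and> K \<subseteq> L \<and> x \<in> L}"

(* A polynomial in the variables X_0, X_1, ... is a finitely supported map from monomials
   to coefficients, a monomial being a finitely supported map from indices to exponents. *)
definition mpoly_eval :: "(nat \<Rightarrow> 'a) \<Rightarrow> ((nat \<Rightarrow>\<^sub>0 nat) \<Rightarrow>\<^sub>0 'a) \<Rightarrow> 'a::field" where
  "mpoly_eval x p =
     (\<Sum>m\<in>Poly_Mapping.keys p. Poly_Mapping.lookup p m *
       (\<Prod>i\<in>Poly_Mapping.keys m. x i ^ Poly_Mapping.lookup m i))"

definition sigma_alg_dependent :: "('a::field \<Rightarrow> 'a) \<Rightarrow> 'a set \<Rightarrow> 'a \<Rightarrow> bool" where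
  "sigma_alg_dependent \<sigma> E f \<longleftrightarrow>
     (\<exists>p :: (nat \<Rightarrow>\<^sub>0 nat) \<Rightarrow>\<^sub>0 'a. p \<noteq> 0 \<and> (\<forall>m. Poly_Mapping.lookup p m \<in> E) \<and>
        mpoly_eval (\<lambda>i. (\<sigma> ^^ i) f) p = 0)"

definition mult_fun :: "('a::field \<Rightarrow> 'a) \<Rightarrow> nat \<Rightarrow> (nat \<Rightarrow> int) \<Rightarrow> 'a \<Rightarrow> 'a" where
  "mult_fun \<sigma> t n x = (\<Prod>i<t. (\<sigma> ^^ i) x powi n i)"

type_synonym ratfun = "complex poly fract"

definition rat_const :: "complex \<Rightarrow> ratfun" where
  "rat_const c = Fract [:c:] 1"

definition rat_z :: ratfun where
  "rat_z = Fract [:0, 1:] 1"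

(* The inclusion of the rational functions into the field is given by \<iota>;
   field homomorphisms are automatically injective. *)
locale phi_sigma_field_over_ratfun =
  phi_sigma_field \<phi> \<sigma> + incl: field_hom \<iota>
  for \<phi> \<sigma> :: "'a::field \<Rightarrow> 'a" and \<iota> :: "ratfun \<Rightarrow> 'a" +
  fixes a1 a2 b1 b2 :: complex
  assumes phi_const: "\<phi> (\<iota> (rat_const c)) = \<iota> (rat_const c)"
    and sigma_const: "\<sigma> (\<iota> (rat_const c)) = \<iota> (rat_const c)"
    and phi_z: "\<phi> (\<iota> rat_z) = \<iota> (rat_const a1 * rat_z + rat_const a2)"
    and sigma_z: "\<sigma> (\<iota> rat_z) = \<iota> (rat_const b1 * rat_z + rat_const b2)"
    and a1_b1_nonzero: "a1 * b1 \<noteq> 0"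
    and phi_infinite_order: "n \<ge> 1 \<Longrightarrow> \<exists>r. (\<phi> ^^ n) (\<iota> r) \<noteq> \<iota> r"

end

theory Submission
  imports
    Defs
    "HOL-Computational_Algebra.Fundamental_Theorem_Algebra"
begin

text \<open>
  From \<open>\<phi> f = a f\<close> and \<open>\<phi> \<sigma> = \<sigma> \<phi>\<close>, every monomial in \<open>f, \<sigma> f, \<sigma>\<^sup>2 f, \<dots>\<close> is an eigenvector of \<open>\<phi>\<close>
  whose eigenvalue is the same monomial in \<open>a, \<sigma> a, \<sigma>\<^sup>2 a, \<dots>\<close>. An algebraic relation for \<open>f\<close> is
  thus a linear relation over \<open>k(z)\<close> between eigenvectors.

  If \<open>\<phi>(b)/b\<close> is the eigenvalue of a Laurent monomial in the \<open>\<sigma> ^^ i\<close> of \<open>f\<close>, then that Laurent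
  monomial divided by \<open>b\<close> is fixed by \<open>\<phi>\<close>, so the Laurent monomial itself lies in \<open>k(z)\<close>: a relation
  with two terms (\<open>dependent_if_multiplicative_relation\<close>).

  Conversely, Artin's shortening argument (\<open>eigenvector_relation\<close>) extracts from any relation two
  distinct monomials whose quotient of eigenvalues \<open>r\<close> has the form \<open>\<phi>(d)/d\<close> with \<open>d\<close> in
  \<open>k(z)\<close>. It remains to replace \<open>d\<close> by a rational function over the complex numbers. Because \<open>\<phi>\<close> has
  infinite order on \<open>z\<close>, the element \<open>z\<close> is transcendental over \<open>k\<close> (\<open>z_transcendental\<close>), so that
  \<open>\<phi> d = r d\<close> is an identity between polynomials. Write \<open>d = d\<^sub>1 d\<^sub>2\<close>, where \<open>d\<^sub>1\<close> collects the zeros and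
  poles of \<open>d\<close> at complex numbers. As \<open>r\<close> has complex coefficients and
  \<open>z \<mapsto> a1 z + a2\<close> preserves the complex numbers, the two parts cannot interact: \<open>\<phi>(d\<^sub>1)/d\<^sub>1\<close>
  is \<open>r\<close> up to the constant \<open>\<phi>(d\<^sub>2)/d\<^sub>2\<close>, which leading coefficients identify as a power of \<open>a1\<close>. A power of
  \<open>z - w\<close>, with \<open>w\<close> the fixed point of \<open>z \<mapsto> a1 z + a2\<close>, absorbs it; for \<open>a1 = 1\<close> there is nothing to
  absorb (\<open>descent_to_constants\<close>).
\<close>

section \<open>Field homomorphisms and polynomials\<close>

context field_hom
begin

lemma hom_zero: "h 0 = 0"
  using hom_add[of 0 0] by (metis add.right_neutral add_cancel_right_right)

lemma hom_minus: "h (- x) = - h x"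
  using hom_add[of x "- x"] by (simp add: hom_zero eq_neg_iff_add_eq_0 add.commute)

lemma hom_diff: "h (x - y) = h x - h y"
  using hom_add[of x "- y"] by (simp add: hom_minus)

lemma hom_eq_0_iff: "h x = 0 \<longleftrightarrow> x = 0"
proof
  assume "h x = 0"
  then have "x = 0 \<or> h (x * inverse x) = 0" by (simp add: hom_mult)
  then show "x = 0" by (cases "x = 0") (auto simp: hom_one)
qed (simp add: hom_zero)

lemma hom_eq_iff: "h x = h y \<longleftrightarrow> x = y"
  using hom_eq_0_iff[of "x - y"] by (simp add: hom_diff)

lemma hom_inverse: "h (inverse x) = inverse (h x)"
proof (cases "x = 0")
  case False
  then have "h x * h (inverse x) = 1" by (simp flip: hom_mult add: hom_one)
  then show ?thesis by (metis inverse_unique)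
qed (simp add: hom_zero)

lemma hom_divide: "h (x / y) = h x / h y"
  by (simp add: divide_inverse hom_mult hom_inverse)

lemma hom_power: "h (x ^ n) = h x ^ n"
  by (induction n) (simp_all add: hom_one hom_mult)

lemma hom_power_int: "h (x powi n) = h x powi n"
  by (simp add: power_int_def hom_power hom_inverse)

lemma hom_sum: "h (\<Sum>i\<in>A. g i) = (\<Sum>i\<in>A. h (g i))"
  by (induction A rule: infinite_finite_induct) (simp_all add: hom_zero hom_add)

lemma hom_prod: "h (\<Prod>i\<in>A. g i) = (\<Prod>i\<in>A. h (g i))"
  by (induction A rule: infinite_finite_induct) (simp_all add: hom_one hom_mult)

lemma map_poly_pCons_hom: "map_poly h (pCons c p) = pCons (h c) (map_poly h p)"
  by (simp add: map_poly_pCons hom_zero)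

lemma map_poly_add_hom: "map_poly h (p + q) = map_poly h p + map_poly h q"
  by (simp add: poly_eq_iff coeff_map_poly hom_zero hom_add)

lemma map_poly_diff_hom: "map_poly h (p - q) = map_poly h p - map_poly h q"
  by (simp add: poly_eq_iff coeff_map_poly hom_zero hom_diff)

lemma map_poly_mult_hom: "map_poly h (p * q) = map_poly h p * map_poly h q"
  by (simp add: poly_eq_iff coeff_map_poly hom_zero coeff_mult hom_sum hom_mult)

lemma map_poly_smult_hom: "map_poly h (smult c p) = smult (h c) (map_poly h p)"
  by (simp add: poly_eq_iff coeff_map_poly hom_zero hom_mult)

lemma map_poly_pcompose_hom: "map_poly h (p \<circ>\<^sub>p q) = map_poly h p \<circ>\<^sub>p map_poly h q"
  by (induction p)
     (simp_all add: pcompose_pCons map_poly_pCons_hom map_poly_add_hom map_poly_mult_hom)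

lemma hom_poly: "h (poly p x) = poly (map_poly h p) (h x)"
  by (induction p) (simp_all add: map_poly_pCons_hom hom_zero hom_add hom_mult)

lemma map_poly_eq_0_hom: "map_poly h p = 0 \<longleftrightarrow> p = 0"
  by (simp add: poly_eq_iff coeff_map_poly hom_zero hom_eq_0_iff)

end

section \<open>Subfields and adjunction\<close>

lemma is_subfield_mult: "is_subfield K \<Longrightarrow> x \<in> K \<Longrightarrow> y \<in> K \<Longrightarrow> x * y \<in> K"
  and is_subfield_add: "is_subfield K \<Longrightarrow> x \<in> K \<Longrightarrow> y \<in> K \<Longrightarrow> x + y \<in> K"
  and is_subfield_minus: "is_subfield K \<Longrightarrow> x \<in> K \<Longrightarrow> - x \<in> K"
  and is_subfield_inverse: "is_subfield K \<Longrightarrow> x \<in> K \<Longrightarrow> inverse x \<in> K"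
  and is_subfield_0: "is_subfield K \<Longrightarrow> 0 \<in> K"
  and is_subfield_1: "is_subfield K \<Longrightarrow> 1 \<in> K"
  by (auto simp: is_subfield_def)

lemma is_subfield_diff: "is_subfield K \<Longrightarrow> x \<in> K \<Longrightarrow> y \<in> K \<Longrightarrow> x - y \<in> K"
  using is_subfield_add[of K x "- y"] is_subfield_minus by auto

lemma is_subfield_divide: "is_subfield K \<Longrightarrow> x \<in> K \<Longrightarrow> y \<in> K \<Longrightarrow> x / y \<in> K"
  by (simp add: divide_inverse is_subfield_mult is_subfield_inverse)

lemma is_subfield_power: "is_subfield K \<Longrightarrow> x \<in> K \<Longrightarrow> x ^ n \<in> K"
  by (induction n) (auto simp: is_subfield_1 is_subfield_mult)

lemma is_subfield_power_int: "is_subfield K \<Longrightarrow> x \<in> K \<Longrightarrow> x powi n \<in> K"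
  by (simp add: power_int_def is_subfield_power is_subfield_inverse)

lemma is_subfield_prod:
  "is_subfield K \<Longrightarrow> (\<And>i. i \<in> A \<Longrightarrow> g i \<in> K) \<Longrightarrow> (\<Prod>i\<in>A. g i) \<in> K"
  by (induction A rule: infinite_finite_induct) (auto simp: is_subfield_1 is_subfield_mult)

lemma is_subfield_poly:
  assumes "is_subfield K" "\<And>i. coeff p i \<in> K" "x \<in> K"
  shows "poly p x \<in> K"
  using assms(2)
proof (induction p)
  case (pCons c p)
  have "coeff p i \<in> K" for i
    using pCons.prems[of "Suc i"] by simp
  moreover have "c \<in> K"
    using pCons.prems[of 0] by simp
  ultimately show ?case
    using pCons.IH assms(1,3) by (auto intro!: is_subfield_add is_subfield_mult)
qed (simp add: is_subfield_0 assms(1))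

lemma is_subfield_adjoin: "is_subfield (adjoin K x)"
  unfolding adjoin_def is_subfield_def by blast

lemma subset_adjoin: "K \<subseteq> adjoin K x"
  and mem_adjoin: "x \<in> adjoin K x"
  unfolding adjoin_def by blast+

lemma (in field_hom) is_subfield_range: "is_subfield (range h)"
  unfolding is_subfield_def
  by (auto simp flip: hom_add hom_mult hom_minus hom_inverse)
     (metis hom_zero rangeI, metis hom_one rangeI)

text \<open>
  A polynomial has coefficients in the fixed field of \<open>h\<close> exactly if \<open>map_poly h\<close> fixes it. In this
  form, closure of these polynomials under ring operations and composition is immediate, because
  \<open>map_poly h\<close> is a homomorphism.
\<close>

lemma adjoin_fixed_field_eq:
  assumes "field_hom h"
  shows "adjoin (fixed_field h) x =
    {poly P x / poly Q x | P Q. map_poly h P = P \<and> map_poly h Q = Q \<and> poly Q x \<noteq> 0}"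
    (is "_ = ?R")
proof
  interpret field_hom h by fact
  have one: "map_poly h 1 = 1"
    by (simp add: hom_one)
  have memI: "s \<in> ?R"
    if "s = poly P x / poly Q x" "map_poly h P = P" "map_poly h Q = Q" "poly Q x \<noteq> 0" for s P Q
    using that by blast
  have "is_subfield ?R"
    unfolding is_subfield_def
  proof (intro conjI ballI)
    show "0 \<in> ?R"
      by (rule memI[of _ 0 1]) (simp_all add: one)
    show "1 \<in> ?R"
      by (rule memI[of _ 1 1]) (simp_all add: one)
  next
    fix s t assume "s \<in> ?R" "t \<in> ?R"
    then obtain P Q P' Q' where
      s: "s = poly P x / poly Q x" "map_poly h P = P" "map_poly h Q = Q" "poly Q x \<noteq> 0" and
      t: "t = poly P' x / poly Q' x" "map_poly h P' = P'" "map_poly h Q' = Q'" "poly Q' x \<noteq> 0"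
      by blast
    show "s + t \<in> ?R"
      by (rule memI[of _ "P * Q' + P' * Q" "Q * Q'"])
         (use s t in \<open>simp_all add: map_poly_add_hom map_poly_mult_hom add_frac_eq\<close>)
    show "s * t \<in> ?R"
      by (rule memI[of _ "P * P'" "Q * Q'"]) (use s t in \<open>simp_all add: map_poly_mult_hom\<close>)
  next
    fix s assume "s \<in> ?R"
    then obtain P Q where
      s: "s = poly P x / poly Q x" "map_poly h P = P" "map_poly h Q = Q" "poly Q x \<noteq> 0"
      by blast
    have "map_poly h (0 - P) = 0 - P"
      unfolding map_poly_diff_hom s(2) by simp
    then show "- s \<in> ?R"
      by (intro memI[of _ "0 - P" Q]) (use s in simp_all)
    show "inverse s \<in> ?R"
    proof (cases "poly P x = 0")
      case True
      then show ?thesis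
        by (intro memI[of _ 0 1]) (simp_all add: s(1) one)
    next
      case False
      then show ?thesis
        by (intro memI[of _ Q P]) (use s in simp_all)
    qed
  qed
  moreover have "fixed_field h \<subseteq> ?R"
  proof
    fix c assume "c \<in> fixed_field h"
    then show "c \<in> ?R"
      by (intro memI[of _ "[:c:]" 1])
         (simp_all add: one fixed_field_def map_poly_pCons_hom)
  qed
  moreover have "x \<in> ?R"
    by (rule memI[of _ "[:0, 1:]" 1]) (simp_all add: one map_poly_pCons_hom hom_zero hom_one)
  ultimately show "adjoin (fixed_field h) x \<subseteq> ?R"
    unfolding adjoin_def by blast
  have "poly P x \<in> adjoin (fixed_field h) x" if "map_poly h P = P" for P
  proof -
    have "coeff P i \<in> adjoin (fixed_field h) x" for i
    proof -
      have "h (coeff P i) = coeff P i"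
        using that coeff_map_poly[of h P i] hom_zero by simp
      then show ?thesis
        by (intro subsetD[OF subset_adjoin]) (simp add: fixed_field_def)
    qed
    then show ?thesis
      by (intro is_subfield_poly is_subfield_adjoin mem_adjoin)
  qed
  then show "?R \<subseteq> adjoin (fixed_field h) x"
    by (auto intro!: is_subfield_divide is_subfield_adjoin)
qed

section \<open>A linear relation between eigenvectors\<close>

text \<open>
  Artin's argument for the independence of characters. Normalise the coefficient at \<open>m0\<close> to \<open>1\<close>,
  multiply the relation by \<open>\<alpha> m0\<close>, and subtract its image under \<open>h\<close>: the term of \<open>m0\<close> cancels.
  Either some other term cancels too, which is the asserted equation, or the result is a shorter
  relation of the same kind.
\<close>

lemma eigenvector_relation:
  assumes "field_hom h" "is_subfield E" and hE: "\<And>x. x \<in> E \<Longrightarrow> h x \<in> E"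
    and v: "\<And>m. h (v m) = \<alpha> m * v m" "\<And>m. v m \<noteq> 0" "\<And>m. \<alpha> m \<in> E"
    and "finite M" "M \<noteq> {}"
    and "\<And>m. m \<in> M \<Longrightarrow> c m \<in> E - {0}" "(\<Sum>m\<in>M. c m * v m) = 0"
  shows "\<exists>m0\<in>M. \<exists>m\<in>M. m \<noteq> m0 \<and> (\<exists>d\<in>E. d \<noteq> 0 \<and> h d * \<alpha> m = \<alpha> m0 * d)"
  using assms(7-)
proof (induction M arbitrary: c rule: finite_psubset_induct)
  case (psubset M)
  interpret field_hom h by fact
  obtain m0 where m0: "m0 \<in> M"
    using psubset.prems by blast
  have c0: "c m0 \<noteq> 0" and cE: "\<And>m. m \<in> M \<Longrightarrow> c m \<in> E"
    using m0 psubset.prems(2) by blast+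
  define d where "d m = c m / c m0" for m
  have dE: "d m \<in> E" "d m \<noteq> 0" if "m \<in> M" for m
    using that m0 psubset.prems(2) cE assms(2) by (auto simp: d_def intro: is_subfield_divide)
  have d0: "(\<Sum>m\<in>M. d m * v m) = 0"
    using psubset.prems(3) by (simp add: d_def flip: sum_divide_distrib)
  define e where "e m = \<alpha> m0 * d m - h (d m) * \<alpha> m" for m
  have eE: "e m \<in> E" if "m \<in> M" for m
    using dE(1)[OF that] hE v(3) assms(2)
    by (auto simp: e_def intro!: is_subfield_diff is_subfield_mult)
  have "(\<Sum>m\<in>M. e m * v m) = \<alpha> m0 * (\<Sum>m\<in>M. d m * v m) - h (\<Sum>m\<in>M. d m * v m)"
    by (simp add: e_def hom_sum hom_mult v(1) sum_distrib_left algebra_simps sum_subtractf)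
  then have "(\<Sum>m\<in>M. e m * v m) = 0"
    using d0 by (simp add: hom_zero)
  moreover have "e m0 = 0"
    using c0 by (simp add: e_def d_def hom_one)
  ultimately have e0: "(\<Sum>m\<in>M - {m0}. e m * v m) = 0"
    using m0 psubset.hyps by (simp add: sum.remove)
  have ne: "M - {m0} \<noteq> {}"
  proof
    assume "M - {m0} = {}"
    then have "M = {m0}" using m0 by blast
    then show False using psubset.prems(3) c0 v(2) by simp
  qed
  show ?case
  proof (cases "\<exists>m\<in>M - {m0}. e m = 0")
    case True
    then obtain m where m: "m \<in> M" "m \<noteq> m0" "e m = 0" by blast
    then have "h (d m) * \<alpha> m = \<alpha> m0 * d m" by (simp add: e_def)
    then show ?thesis using m m0 dE by blast
  next
    case False
    have "\<exists>m1\<in>M - {m0}. \<exists>m\<in>M - {m0}. m \<noteq> m1 \<and> (\<exists>d\<in>E. d \<noteq> 0 \<and> h d * \<alpha> m = \<alpha> m1 * d)"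
      using False eE m0 ne e0 by (intro psubset.IH[of _ e]) auto
    then show ?thesis by blast
  qed
qed

section \<open>Descent of a first-order equation to an algebraically closed constant field\<close>

text \<open>Splitting off the linear factors that belong to the roots in \<open>range j\<close>.\<close>

lemma split_off_roots:
  fixes j :: "'k::field \<Rightarrow> 'a::field"
  assumes "field_hom j" "P \<noteq> 0"
  shows "\<exists>p R. p \<noteq> 0 \<and> P = map_poly j p * R \<and> (\<forall>x. poly R (j x) \<noteq> 0)"
  using assms(2)
proof (induction "degree P" arbitrary: P rule: less_induct)
  case less
  interpret field_hom j by fact
  show ?case
  proof (cases "\<exists>x. poly P (j x) = 0")
    case False
    then show ?thesis
      by (intro exI[of _ 1] exI[of _ P]) (auto simp: hom_one)
  next
    case True
    then obtain x where "poly P (j x) = 0" by blast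
    then obtain P' where P': "P = [:- j x, 1:] * P'"
      by (auto simp: poly_eq_0_iff_dvd)
    with less.prems have "P' \<noteq> 0" by auto
    then have "degree P = Suc (degree P')"
      unfolding P' by (subst degree_mult_eq) auto
    then obtain p R where "p \<noteq> 0" "P' = map_poly j p * R" "\<forall>x. poly R (j x) \<noteq> 0"
      using less.hyps \<open>P' \<noteq> 0\<close> by (metis lessI)
    moreover have "map_poly j ([:- x, 1:] * p) = [:- j x, 1:] * map_poly j p"
      by (simp only: map_poly_mult_hom) (simp add: map_poly_pCons_hom hom_minus hom_one)
    ultimately show ?thesis
      unfolding P' by (intro exI[of _ "[:- x, 1:] * p"] exI[of _ R])
        (simp only: mult.assoc mult_eq_0_iff pCons_eq_0_iff one_neq_zero simp_thms)
  qed
qed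

text \<open>
  Up to constants, such a splitting is unique: the split-off factor is determined by its roots
  with multiplicities, and these can be read off from the product.
\<close>

lemma split_off_roots_unique:
  fixes j :: "'k::alg_closed_field \<Rightarrow> 'a::field"
  assumes "field_hom j" "p \<noteq> 0" "q \<noteq> 0" "map_poly j p * A = map_poly j q * B"
    and A: "\<And>x. poly A (j x) \<noteq> 0" and B: "\<And>x. poly B (j x) \<noteq> 0"
  shows "\<exists>c. p = smult c q"
  using assms(2-4)
proof (induction "degree p" arbitrary: p q rule: less_induct)
  case less
  interpret field_hom j by fact
  have roots: "poly p x = 0 \<longleftrightarrow> poly q x = 0" for x
  proof -
    have "j (poly p x) * poly A (j x) = j (poly q x) * poly B (j x)"
      using arg_cong[OF less.prems(3), of "\<lambda>r. poly r (j x)"] by (simp add: hom_poly)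
    then show ?thesis
      using A B by (metis hom_eq_0_iff mult_eq_0_iff)
  qed
  show ?case
  proof (cases "degree p = 0")
    case True
    then obtain c where c: "p = [:c:]" by (auto elim: degree_eq_zeroE)
    then have "c \<noteq> 0" using less.prems by auto
    then have "degree q = 0"
      using roots alg_closed_imp_poly_has_root[of q] by (auto simp: c)
    then obtain d where d: "q = [:d:]" by (auto elim: degree_eq_zeroE)
    then have "p = smult (c / d) q" using c less.prems by auto
    then show ?thesis by blast
  next
    case False
    then obtain x where "poly p x = 0"
      using alg_closed_imp_poly_has_root[of p] by auto
    then obtain p' q' where pq: "p = [:- x, 1:] * p'" "q = [:- x, 1:] * q'"
      using roots[of x] by (auto simp: poly_eq_0_iff_dvd elim!: dvdE)
    then have ne: "p' \<noteq> 0" "q' \<noteq> 0" using less.prems by auto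
    have deg: "degree p = Suc (degree p')"
      unfolding pq using ne by (subst degree_mult_eq) auto
    have "map_poly j [:- x, 1:] * (map_poly j p' * A) = map_poly j [:- x, 1:] * (map_poly j q' * B)"
      using less.prems(3) by (simp only: pq map_poly_mult_hom mult.assoc)
    moreover have "map_poly j [:- x, 1:] \<noteq> 0"
      by (simp only: map_poly_eq_0_hom) simp
    ultimately have "map_poly j p' * A = map_poly j q' * B" by simp
    then obtain c where "p' = smult c q'"
      using less.hyps[of p' q'] deg ne by auto
    then show ?thesis
      unfolding pq by (metis mult_smult_right)
  qed
qed

text \<open>
  The equation \<open>P(L)/Q(L) = (u/v) P/Q\<close> with \<open>u, v\<close> over the small field. Split
  \<open>P = p R\<close> and \<open>Q = q S\<close>. The substitution \<open>L\<close> permutes the small field, so \<open>R(L)\<close> and \<open>S(L)\<close> have no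
  roots in it either, and uniqueness of the splitting shows that \<open>p/q\<close> solves the equation up to a
  constant factor \<open>c\<close>. Comparing leading coefficients of the complementary factors,
  \<open>c\<close> is the power \<open>a1 ^ (degree S - degree R)\<close>. Such a factor is removed
  with the help of a polynomial \<open>W\<close> with \<open>W(L) = a1 W\<close>.
\<close>

lemma descent_to_constants:
  fixes j :: "'k::alg_closed_field \<Rightarrow> 'a::field"
  assumes "field_hom j" and a1: "a1 \<noteq> 0" and L: "L = [:a2, a1:]"
    and nz: "P \<noteq> 0" "Q \<noteq> 0" "u \<noteq> 0" "v \<noteq> 0"
    and eq: "(P \<circ>\<^sub>p map_poly j L) * Q * map_poly j v = map_poly j u * P * (Q \<circ>\<^sub>p map_poly j L)"
  shows "\<exists>p q. p \<noteq> 0 \<and> q \<noteq> 0 \<and> (p \<circ>\<^sub>p L) * q * v = u * p * (q \<circ>\<^sub>p L)"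
proof -
  interpret field_hom j by fact
  let ?L = "map_poly j L"
  have degL: "degree L = 1" and degL': "degree ?L = 1" and lcL': "lead_coeff ?L = j a1"
    using a1 by (simp_all add: L map_poly_pCons_hom hom_eq_0_iff)
  obtain p R where P: "P = map_poly j p * R" and p: "p \<noteq> 0" and R: "\<And>x. poly R (j x) \<noteq> 0"
    using split_off_roots[OF assms(1) nz(1)] by blast
  obtain q S where Q: "Q = map_poly j q * S" and q: "q \<noteq> 0" and S: "\<And>x. poly S (j x) \<noteq> 0"
    using split_off_roots[OF assms(1) nz(2)] by blast
  have comp_nz: "r \<circ>\<^sub>p L \<noteq> 0" if "r \<noteq> 0" for r
    using that degL by (metis pcompose_eq_0 zero_less_one)
  have evalL: "poly ?L (j x) = j (poly L x)" for x
    by (simp add: hom_poly)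
  define X where "X = (p \<circ>\<^sub>p L) * q * v"
  define Y where "Y = u * p * (q \<circ>\<^sub>p L)"
  have Y: "Y \<noteq> 0" and X: "X \<noteq> 0"
    using p q nz comp_nz by (auto simp: X_def Y_def)
  have XY: "map_poly j X * ((R \<circ>\<^sub>p ?L) * S) = map_poly j Y * (R * (S \<circ>\<^sub>p ?L))"
    using eq
    by (simp add: X_def Y_def P Q map_poly_mult_hom map_poly_pcompose_hom pcompose_mult mult_ac)
  have "\<exists>c. X = smult c Y"
    using X Y XY R S
    by (intro split_off_roots_unique[OF assms(1)]) (auto simp: poly_pcompose evalL)
  then obtain c where c: "X = smult c Y" by blast
  have "map_poly j Y * smult (j c) ((R \<circ>\<^sub>p ?L) * S) = map_poly j Y * (R * (S \<circ>\<^sub>p ?L))"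
    using XY unfolding c map_poly_smult_hom by simp
  then have "smult (j c) ((R \<circ>\<^sub>p ?L) * S) = R * (S \<circ>\<^sub>p ?L)"
    using Y map_poly_eq_0_hom mult_left_cancel by blast
  then have "lead_coeff (smult (j c) ((R \<circ>\<^sub>p ?L) * S)) = lead_coeff (R * (S \<circ>\<^sub>p ?L))"
    by (rule arg_cong)
  then have "j c * (lead_coeff R * j a1 ^ degree R * lead_coeff S) =
      lead_coeff R * (lead_coeff S * j a1 ^ degree S)"
    using degL' lcL' by (simp only: lead_coeff_smult lead_coeff_mult lead_coeff_comp)
  moreover have "R \<noteq> 0" "S \<noteq> 0"
    using R S by fastforce+
  ultimately have "j c * j a1 ^ degree R = j a1 ^ degree S"
    by (simp add: mult_ac)
  then have const: "c * a1 ^ degree R = a1 ^ degree S"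
    by (simp flip: hom_power hom_mult add: hom_eq_iff)
  \<comment> \<open>For \<open>a1 \<noteq> 1\<close>, the root of \<open>W\<close> is the fixed point of \<open>L\<close>.\<close>
  obtain W where W: "W \<noteq> 0" "W \<circ>\<^sub>p L = smult a1 W"
  proof (cases "a1 = 1")
    case True
    show ?thesis by (rule that[of 1]) (simp_all add: True pcompose_1)
  next
    case False
    show ?thesis
      by (rule that[of "[:- (a2 / (1 - a1)), 1:]"])
         (use False in \<open>simp_all add: L pcompose_pCons field_simps\<close>)
  qed
  have W_pow: "W ^ n \<circ>\<^sub>p L = smult (a1 ^ n) (W ^ n)" for n
    by (induction n) (simp_all add: pcompose_1 pcompose_mult W mult_ac)
  define p' where "p' = p * W ^ degree R"
  define q' where "q' = q * W ^ degree S"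
  have "(p' \<circ>\<^sub>p L) * q' * v = smult (a1 ^ degree R) (X * (W ^ degree R * W ^ degree S))"
    by (simp add: p'_def q'_def X_def pcompose_mult W_pow mult_ac)
  also have "\<dots> = smult (a1 ^ degree S) (Y * (W ^ degree R * W ^ degree S))"
    by (simp add: c mult.commute flip: const)
  also have "\<dots> = u * p' * (q' \<circ>\<^sub>p L)"
    by (simp add: p'_def q'_def Y_def pcompose_mult W_pow mult_ac)
  finally show ?thesis
    using p q W by (intro exI[of _ p'] exI[of _ q']) (auto simp: p'_def q'_def)
qed

section \<open>The field over the rational functions\<close>

context phi_sigma_field_over_ratfun
begin

abbreviation const :: "complex \<Rightarrow> 'a" where "const c \<equiv> \<iota> (rat_const c)"
abbreviation z :: 'a where "z \<equiv> \<iota> rat_z"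
abbreviation shift :: "complex poly" where "shift \<equiv> [:a2, a1:]"

sublocale const: field_hom const
proof
  show "const 1 = 1"
    by (simp add: rat_const_def incl.hom_one flip: One_fract_def one_pCons)
  show "const (x + y) = const x + const y" for x y
    by (simp add: rat_const_def flip: incl.hom_add)
  show "const (x * y) = const x * const y" for x y
    by (simp add: rat_const_def mult.commute flip: incl.hom_mult)
qed

lemma incl_Fract_1: "\<iota> (Fract p 1) = poly (map_poly const p) z"
proof (induction p)
  case 0
  then show ?case by (simp add: incl.hom_zero flip: Zero_fract_def)
next
  case (pCons c p)
  have "Fract (pCons c p) 1 = rat_const c + rat_z * Fract p 1"
    by (simp add: rat_const_def rat_z_def)
  then show ?case
    using pCons by (simp add: incl.hom_add incl.hom_mult const.map_poly_pCons_hom)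
qed

lemma poly_const_z_nz: "q \<noteq> 0 \<Longrightarrow> poly (map_poly const q) z \<noteq> 0"
  by (simp flip: incl_Fract_1 add: incl.hom_eq_0_iff Zero_fract_def eq_fract)

lemma incl_Fract:
  assumes "q \<noteq> 0"
  shows "\<iota> (Fract p q) = poly (map_poly const p) z / poly (map_poly const q) z"
proof -
  have "Fract p q = Fract p 1 / Fract q 1"
    using assms by simp
  then show ?thesis by (simp only: incl.hom_divide incl_Fract_1)
qed

lemma phi_map_poly_const: "map_poly \<phi> (map_poly const p) = map_poly const p"
  and sigma_map_poly_const: "map_poly \<sigma> (map_poly const p) = map_poly const p"
  by (simp_all add: poly_eq_iff coeff_map_poly const.hom_zero phi.hom_zero sigma.hom_zero
      phi_const sigma_const)

lemma phi_z_shift: "\<phi> z = poly (map_poly const shift) z"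
  using phi_z by (simp add: const.map_poly_pCons_hom incl.hom_add incl.hom_mult)

lemma phi_poly_z: "map_poly \<phi> P = P \<Longrightarrow> \<phi> (poly P z) = poly (P \<circ>\<^sub>p map_poly const shift) z"
  by (simp add: phi.hom_poly phi_z_shift poly_pcompose)

lemma phi_funpow_sigma: "\<phi> ((\<sigma> ^^ i) x) = (\<sigma> ^^ i) (\<phi> x)"
  by (induction i) (simp_all add: phi_sigma_commute)

lemma sigma_funpow_mult: "(\<sigma> ^^ i) (x * y) = (\<sigma> ^^ i) x * (\<sigma> ^^ i) y"
  by (induction i) (simp_all add: sigma.hom_mult)

lemma sigma_funpow_eq_0_iff: "(\<sigma> ^^ i) x = 0 \<longleftrightarrow> x = 0"
  by (induction i) (simp_all add: sigma.hom_eq_0_iff)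

lemma sigma_range_incl: "\<sigma> (\<iota> r) \<in> range \<iota>"
proof (cases r)
  case (Fract p q)
  let ?M = "[:b2, b1:]"
  have "\<sigma> z = poly (map_poly const ?M) z"
    using sigma_z by (simp add: const.map_poly_pCons_hom incl.hom_add incl.hom_mult)
  then have "\<sigma> (poly (map_poly const s) z) = \<iota> (Fract (s \<circ>\<^sub>p ?M) 1)" for s
    unfolding incl_Fract_1
    by (simp add: sigma.hom_poly sigma_map_poly_const const.map_poly_pcompose_hom poly_pcompose)
  then have "\<sigma> (\<iota> r) = \<iota> (Fract (p \<circ>\<^sub>p ?M) 1) / \<iota> (Fract (q \<circ>\<^sub>p ?M) 1)"
    unfolding Fract(1) incl_Fract[OF Fract(2)] sigma.hom_divide by simp
  then show ?thesis
    by (simp add: is_subfield_divide incl.is_subfield_range)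
qed

lemma sigma_funpow_range_incl: "(\<sigma> ^^ i) (\<iota> r) \<in> range \<iota>"
proof (induction i)
  case (Suc i)
  then show ?case using sigma_range_incl by auto
qed simp

text \<open>
  A nonzero polynomial over the \<open>\<phi>\<close>-constants that vanishes at \<open>z\<close> vanishes at every iterate
  \<open>(\<phi> ^^ n) z\<close>, and these iterates are distinct because \<open>\<phi>\<close> has infinite order.
\<close>

lemma z_transcendental:
  assumes "map_poly \<phi> P = P" "poly P z = 0"
  shows "P = 0"
proof (rule ccontr)
  assume "P \<noteq> 0"
  have phi_pow_inj: "(\<phi> ^^ n) x = (\<phi> ^^ n) y \<longleftrightarrow> x = y" for n x y
    by (induction n) (simp_all add: phi.hom_eq_iff)
  have phi_pow_poly: "(\<phi> ^^ n) (poly S x) = poly S ((\<phi> ^^ n) x)" if "map_poly \<phi> S = S" for n S x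
    using that by (induction n) (simp_all add: phi.hom_poly)
  have no_period: "(\<phi> ^^ n) z \<noteq> z" if n: "n \<ge> 1" for n
  proof
    assume "(\<phi> ^^ n) z = z"
    then have fix_poly: "(\<phi> ^^ n) (poly (map_poly const s) z) = poly (map_poly const s) z" for s
      by (simp add: phi_pow_poly phi_map_poly_const)
    have phi_pow_divide: "(\<phi> ^^ n) (x / y) = (\<phi> ^^ n) x / (\<phi> ^^ n) y" for x y
      by (induction n) (simp_all add: phi.hom_divide)
    have "(\<phi> ^^ n) (\<iota> r) = \<iota> r" for r
      by (cases r) (simp add: incl_Fract phi_pow_divide fix_poly)
    then show False
      using phi_infinite_order[OF n] by blast
  qed
  have "inj (\<lambda>n. (\<phi> ^^ n) z)"
  proof (rule linorder_injI)
    fix m n :: nat assume "m < n"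
    then have "(\<phi> ^^ n) z = (\<phi> ^^ m) ((\<phi> ^^ (n - m)) z)"
      using funpow_add[of m "n - m" \<phi>] by simp
    then show "(\<phi> ^^ m) z \<noteq> (\<phi> ^^ n) z"
      using no_period[of "n - m"] \<open>m < n\<close> by (metis One_nat_def Suc_leI phi_pow_inj zero_less_diff)
  qed
  then have "infinite (range (\<lambda>n. (\<phi> ^^ n) z))"
    by (rule range_inj_infinite)
  moreover have "poly P ((\<phi> ^^ n) z) = 0" for n
  proof -
    have "(\<phi> ^^ n) 0 = 0"
      by (induction n) (simp_all add: phi.hom_zero)
    then show ?thesis
      using phi_pow_poly[OF assms(1), of n z] assms(2) by simp
  qed
  then have "range (\<lambda>n. (\<phi> ^^ n) z) \<subseteq> {x. poly P x = 0}" by blast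
  ultimately show False
    using poly_roots_finite[OF \<open>P \<noteq> 0\<close>] finite_subset by blast
qed

abbreviation kz :: "'a set" where "kz \<equiv> adjoin (fixed_field \<phi>) z"

lemma kz_eq:
  "kz = {poly P z / poly Q z | P Q. map_poly \<phi> P = P \<and> map_poly \<phi> Q = Q \<and> poly Q z \<noteq> 0}"
  by (rule adjoin_fixed_field_eq) (rule phi.field_hom_axioms)

lemma range_incl_subset_kz: "range \<iota> \<subseteq> kz"
proof
  fix x assume "x \<in> range \<iota>"
  then obtain r where r: "x = \<iota> r" by blast
  obtain p q where "r = Fract p q" "q \<noteq> 0" by (cases r)
  then show "x \<in> kz"
    unfolding kz_eq r using poly_const_z_nz[of q] phi_map_poly_const
    by (auto simp: incl_Fract)
qed

lemma phi_kz:
  assumes "x \<in> kz"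
  shows "\<phi> x \<in> kz"
proof -
  obtain P Q where x: "x = poly P z / poly Q z" and fixed: "map_poly \<phi> P = P" "map_poly \<phi> Q = Q"
    and nz: "poly Q z \<noteq> 0"
    using assms unfolding kz_eq by blast
  have "map_poly \<phi> (S \<circ>\<^sub>p map_poly const shift) = S \<circ>\<^sub>p map_poly const shift"
    if "map_poly \<phi> S = S" for S
    using that by (simp only: phi.map_poly_pcompose_hom phi_map_poly_const)
  moreover have "poly (Q \<circ>\<^sub>p map_poly const shift) z \<noteq> 0"
    using nz fixed(2) by (simp flip: phi_poly_z add: phi.hom_eq_0_iff)
  moreover have "\<phi> x = poly (P \<circ>\<^sub>p map_poly const shift) z / poly (Q \<circ>\<^sub>p map_poly const shift) z"
    by (simp add: x phi.hom_divide phi_poly_z fixed)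
  ultimately show ?thesis
    unfolding kz_eq using fixed by blast
qed

text \<open>
  Since \<open>z\<close> is transcendental over the \<open>\<phi>\<close>-constants, the equation \<open>\<phi> c = r c\<close> is an identity
  between polynomials, to which the descent applies.
\<close>

lemma solution_descends_to_ratfun:
  assumes c: "c \<in> kz" "c \<noteq> 0" and r: "r \<noteq> 0" and eq: "\<phi> c = \<iota> r * c"
  shows "\<exists>b. b \<noteq> 0 \<and> \<phi> (\<iota> b) = \<iota> r * \<iota> b"
proof -
  let ?L = "map_poly const shift"
  obtain P Q where c_eq: "c = poly P z / poly Q z"
    and fixed: "map_poly \<phi> P = P" "map_poly \<phi> Q = Q" and Qz: "poly Q z \<noteq> 0"
    using c(1) unfolding kz_eq by blast
  obtain u v where uv: "r = Fract u v" "v \<noteq> 0" by (cases r)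
  have u: "u \<noteq> 0"
    using r uv by (auto simp: fract_collapse)
  have Pz: "P \<noteq> 0" "Q \<noteq> 0"
    using c(2) c_eq Qz by auto
  have QLz: "poly (Q \<circ>\<^sub>p ?L) z \<noteq> 0"
    using Qz fixed(2) by (simp flip: phi_poly_z add: phi.hom_eq_0_iff)
  define D where "D = (P \<circ>\<^sub>p ?L) * Q * map_poly const v - map_poly const u * P * (Q \<circ>\<^sub>p ?L)"
  have "poly (P \<circ>\<^sub>p ?L) z / poly (Q \<circ>\<^sub>p ?L) z =
      poly (map_poly const u) z / poly (map_poly const v) z * (poly P z / poly Q z)"
    using eq by (simp add: c_eq uv incl_Fract phi.hom_divide phi_poly_z fixed)
  then have "poly D z = 0"
    using Qz QLz poly_const_z_nz[OF uv(2)] by (simp add: D_def field_simps)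
  moreover have "map_poly \<phi> D = D"
    unfolding D_def phi.map_poly_diff_hom phi.map_poly_mult_hom phi.map_poly_pcompose_hom
      phi_map_poly_const fixed ..
  ultimately have "D = 0"
    by (intro z_transcendental)
  then obtain p q where pq: "p \<noteq> 0" "q \<noteq> 0" "(p \<circ>\<^sub>p shift) * q * v = u * p * (q \<circ>\<^sub>p shift)"
    using descent_to_constants[OF const.field_hom_axioms _ refl, of a1 P Q u v a2]
      a1_b1_nonzero Pz u uv(2) by (auto simp: D_def)
  let ?e = "\<lambda>s. poly (map_poly const s) z"
  have phi_e: "\<phi> (?e s) = ?e (s \<circ>\<^sub>p shift)" for s
    by (simp add: phi_poly_z phi_map_poly_const const.map_poly_pcompose_hom)
  have e_mult: "?e (s * t) = ?e s * ?e t" for s t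
    by (simp add: const.map_poly_mult_hom)
  have "?e (p \<circ>\<^sub>p shift) * ?e q * ?e v = ?e u * ?e p * ?e (q \<circ>\<^sub>p shift)"
    using pq(3) by (simp flip: e_mult)
  moreover have "?e (q \<circ>\<^sub>p shift) \<noteq> 0"
    unfolding phi_e[symmetric] phi.hom_eq_0_iff by (rule poly_const_z_nz) fact
  ultimately have "\<phi> (\<iota> (Fract p q)) = \<iota> r * \<iota> (Fract p q)"
    using poly_const_z_nz[OF pq(2)] poly_const_z_nz[OF uv(2)]
    unfolding uv(1) incl_Fract[OF pq(2)] incl_Fract[OF uv(2)] phi.hom_divide phi_e
    by (simp add: field_simps)
  moreover have "Fract p q \<noteq> 0"
    using pq by (simp add: Zero_fract_def eq_fract)
  ultimately show ?thesis by blast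
qed

section \<open>Monomials in the transforms of a solution\<close>

definition sigma_monom :: "'a \<Rightarrow> (nat \<Rightarrow>\<^sub>0 nat) \<Rightarrow> 'a" where
  "sigma_monom x m = (\<Prod>i\<in>Poly_Mapping.keys m. (\<sigma> ^^ i) x ^ Poly_Mapping.lookup m i)"

lemma sigma_monom_superset:
  assumes "Poly_Mapping.keys m \<subseteq> {..<t}"
  shows "sigma_monom x m = (\<Prod>i<t. (\<sigma> ^^ i) x ^ Poly_Mapping.lookup m i)"
  unfolding sigma_monom_def using assms
  by (intro prod.mono_neutral_left) (auto simp: not_in_keys_iff_lookup_eq_zero)

lemma sigma_monom_nz: "x \<noteq> 0 \<Longrightarrow> sigma_monom x m \<noteq> 0"
  by (simp add: sigma_monom_def sigma_funpow_eq_0_iff)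

lemma phi_sigma_monom:
  assumes "\<phi> x = y * x"
  shows "\<phi> (sigma_monom x m) = sigma_monom y m * sigma_monom x m"
  by (simp add: sigma_monom_def phi.hom_prod phi.hom_power phi_funpow_sigma assms
      sigma_funpow_mult power_mult_distrib prod.distrib)

lemma mult_fun_eq_monom_quotient:
  assumes "x \<noteq> 0" "Poly_Mapping.keys m \<subseteq> {..<t}" "Poly_Mapping.keys m' \<subseteq> {..<t}"
    and "\<And>i. i < t \<Longrightarrow> n i = int (Poly_Mapping.lookup m i) - int (Poly_Mapping.lookup m' i)"
  shows "mult_fun \<sigma> t n x = sigma_monom x m / sigma_monom x m'"
proof -
  have "(\<sigma> ^^ i) x powi n i =
      (\<sigma> ^^ i) x ^ Poly_Mapping.lookup m i / (\<sigma> ^^ i) x ^ Poly_Mapping.lookup m' i" if "i < t" for i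
    using assms(1,4) that by (simp add: power_int_diff sigma_funpow_eq_0_iff)
  then show ?thesis
    using assms(2,3) by (simp add: mult_fun_def sigma_monom_superset prod_dividef)
qed

lemma phi_mult_fun:
  assumes "\<phi> x = y * x"
  shows "\<phi> (mult_fun \<sigma> t n x) = mult_fun \<sigma> t n y * mult_fun \<sigma> t n x"
  by (simp add: mult_fun_def phi.hom_prod phi.hom_power_int phi_funpow_sigma assms
      sigma_funpow_mult power_int_mult_distrib prod.distrib)

lemma mult_fun_range_incl: "mult_fun \<sigma> t n (\<iota> r) \<in> range \<iota>"
  unfolding mult_fun_def
  by (intro is_subfield_prod is_subfield_power_int incl.is_subfield_range sigma_funpow_range_incl)

lemma sigma_monom_range_incl: "sigma_monom (\<iota> r) m \<in> range \<iota>"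
  unfolding sigma_monom_def
  by (intro is_subfield_prod is_subfield_power incl.is_subfield_range sigma_funpow_range_incl)

text \<open>
  The monomials in \<open>f, \<sigma> f, \<dots>\<close> are eigenvectors of \<open>\<phi>\<close>, with eigenvalues the same monomials in
  \<open>\<sigma> ^^ i\<close> of \<open>a\<close>. A relation between them yields two distinct monomials whose quotient of
  eigenvalues is \<open>\<phi> d / d\<close> over \<open>k(z)\<close>, and this descends.
\<close>

lemma multiplicative_relation_if_dependent:
  assumes f: "f \<noteq> 0" and a: "a \<noteq> 0" and eq: "\<phi> f = \<iota> a * f"
    and dep: "sigma_alg_dependent \<sigma> kz f"
  shows "\<exists>b t n. b \<noteq> 0 \<and> t \<ge> 1 \<and> (\<exists>i<t. n i \<noteq> 0) \<and> mult_fun \<sigma> t n (\<iota> a) = \<phi> (\<iota> b) / \<iota> b"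
proof -
  obtain p where p: "p \<noteq> 0" "\<And>m. Poly_Mapping.lookup p m \<in> kz"
    and "mpoly_eval (\<lambda>i. (\<sigma> ^^ i) f) p = 0"
    using dep unfolding sigma_alg_dependent_def by blast
  then have rel: "(\<Sum>m\<in>Poly_Mapping.keys p. Poly_Mapping.lookup p m * sigma_monom f m) = 0"
    by (simp add: mpoly_eval_def sigma_monom_def)
  have "\<exists>m0\<in>Poly_Mapping.keys p. \<exists>m\<in>Poly_Mapping.keys p. m \<noteq> m0 \<and>
      (\<exists>d\<in>kz. d \<noteq> 0 \<and> \<phi> d * sigma_monom (\<iota> a) m = sigma_monom (\<iota> a) m0 * d)"
  proof (rule eigenvector_relation[where v = "sigma_monom f" and c = "Poly_Mapping.lookup p"])
    show "sigma_monom (\<iota> a) m \<in> kz" for m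
      using sigma_monom_range_incl range_incl_subset_kz by blast
  qed (use p f rel in \<open>auto simp: phi.field_hom_axioms is_subfield_adjoin phi_kz sigma_monom_nz
        phi_sigma_monom[OF eq] in_keys_iff\<close>)
  then obtain m0 m d where m: "m \<noteq> m0" and d: "d \<in> kz" "d \<noteq> 0"
    and d_eq: "\<phi> d * sigma_monom (\<iota> a) m = sigma_monom (\<iota> a) m0 * d"
    by blast
  define n where "n i = int (Poly_Mapping.lookup m0 i) - int (Poly_Mapping.lookup m i)" for i
  have "finite (Poly_Mapping.keys m0 \<union> Poly_Mapping.keys m)" by simp
  then obtain t where t: "Poly_Mapping.keys m0 \<union> Poly_Mapping.keys m \<subseteq> {..<t}"
    unfolding finite_nat_iff_bounded by (elim exE)
  obtain i where i: "Poly_Mapping.lookup m i \<noteq> Poly_Mapping.lookup m0 i"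
    using m by (metis poly_mapping_eqI)
  then have "i \<in> Poly_Mapping.keys m0 \<union> Poly_Mapping.keys m"
    by (auto simp: in_keys_iff)
  then have "i < t"
    using t by blast
  have "\<iota> a \<noteq> 0" using a by (simp add: incl.hom_eq_0_iff)
  then have mf: "mult_fun \<sigma> t n (\<iota> a) = sigma_monom (\<iota> a) m0 / sigma_monom (\<iota> a) m"
    and mf_nz: "mult_fun \<sigma> t n (\<iota> a) \<noteq> 0"
    using mult_fun_eq_monom_quotient[of "\<iota> a" m0 t m n] t sigma_monom_nz
    by (auto simp: n_def)
  obtain r where r: "mult_fun \<sigma> t n (\<iota> a) = \<iota> r"
    using mult_fun_range_incl by blast
  have "\<phi> d = \<iota> r * d"
    using d_eq sigma_monom_nz[OF \<open>\<iota> a \<noteq> 0\<close>, of m] by (simp flip: r add: mf field_simps)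
  moreover have "r \<noteq> 0"
    using mf_nz r incl.hom_zero by auto
  ultimately obtain b where "b \<noteq> 0" "\<phi> (\<iota> b) = \<iota> r * \<iota> b"
    using solution_descends_to_ratfun[OF d] by blast
  then have "mult_fun \<sigma> t n (\<iota> a) = \<phi> (\<iota> b) / \<iota> b"
    by (simp add: r incl.hom_eq_0_iff)
  moreover have "n i \<noteq> 0" using i by (simp add: n_def)
  ultimately show ?thesis
    using \<open>b \<noteq> 0\<close> \<open>i < t\<close>
    by (intro exI[of _ b] exI[of _ t] exI[of _ n]) auto
qed

text \<open>
  If \<open>\<phi>(b)/b\<close> is the eigenvalue of the Laurent monomial \<open>mult_fun \<sigma> t n f\<close>, then this monomial
  divided by \<open>b\<close> is a \<open>\<phi>\<close>-constant. Clearing the negative exponents gives an algebraic relation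
  with two terms.
\<close>

lemma dependent_if_multiplicative_relation:
  assumes f: "f \<noteq> 0" and eq: "\<phi> f = \<iota> a * f"
    and b: "b \<noteq> 0" and n: "i < t" "n i \<noteq> 0"
    and rel: "mult_fun \<sigma> t n (\<iota> a) = \<phi> (\<iota> b) / \<iota> b"
  shows "sigma_alg_dependent \<sigma> kz f"
proof -
  have "\<iota> b \<noteq> 0" using b by (simp add: incl.hom_eq_0_iff)
  define w where "w = mult_fun \<sigma> t n f"
  have "\<phi> (w / \<iota> b) = w / \<iota> b"
    using \<open>\<iota> b \<noteq> 0\<close> phi_mult_fun[OF eq, of t n]
    by (simp add: w_def phi.hom_divide rel phi.hom_eq_0_iff)
  then have "w / \<iota> b \<in> kz"
    by (intro subsetD[OF subset_adjoin]) (simp add: fixed_field_def)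
  then have "w / \<iota> b * \<iota> b \<in> kz"
    using range_incl_subset_kz is_subfield_adjoin by (blast intro: is_subfield_mult)
  then have w: "w \<in> kz" using \<open>\<iota> b \<noteq> 0\<close> by simp
  define m where "m = Poly_Mapping.Abs_poly_mapping (\<lambda>i. if i < t then nat (n i) else 0)"
  define m' where "m' = Poly_Mapping.Abs_poly_mapping (\<lambda>i. if i < t then nat (- n i) else 0)"
  have lookup: "Poly_Mapping.lookup m = (\<lambda>i. if i < t then nat (n i) else 0)"
    "Poly_Mapping.lookup m' = (\<lambda>i. if i < t then nat (- n i) else 0)"
    unfolding m_def m'_def
    by (rule lookup_Abs_poly_mapping, rule finite_subset[of _ "{..<t}"], auto)+
  have keys: "Poly_Mapping.keys m \<subseteq> {..<t}" "Poly_Mapping.keys m' \<subseteq> {..<t}"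
    by (auto simp: in_keys_iff lookup split: if_splits)
  have "w = sigma_monom f m / sigma_monom f m'"
    unfolding w_def using f keys by (intro mult_fun_eq_monom_quotient) (auto simp: lookup)
  then have two_terms: "sigma_monom f m - w * sigma_monom f m' = 0"
    using sigma_monom_nz[OF f, of m'] by simp
  have "m \<noteq> m'"
  proof
    assume "m = m'"
    then have "Poly_Mapping.lookup m i = Poly_Mapping.lookup m' i" by simp
    then show False using n by (auto simp: lookup)
  qed
  define p where "p = Poly_Mapping.single m 1 - Poly_Mapping.single m' w"
  have lookup_p: "Poly_Mapping.lookup p l = (if l = m then 1 else if l = m' then - w else 0)" for l
    using \<open>m \<noteq> m'\<close> by (auto simp: p_def lookup_minus lookup_single when_def)
  have "mpoly_eval (\<lambda>i. (\<sigma> ^^ i) f) p = (\<Sum>l\<in>{m, m'}. Poly_Mapping.lookup p l * sigma_monom f l)"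
    unfolding mpoly_eval_def sigma_monom_def
    by (intro sum.mono_neutral_left) (auto simp: in_keys_iff lookup_p split: if_splits)
  also have "\<dots> = 0"
    using two_terms \<open>m \<noteq> m'\<close> by (simp add: lookup_p)
  finally have "mpoly_eval (\<lambda>i. (\<sigma> ^^ i) f) p = 0" .
  moreover have "p \<noteq> 0"
    using lookup_p[of m] by auto
  moreover have "Poly_Mapping.lookup p l \<in> kz" for l
    using w is_subfield_adjoin[of "fixed_field \<phi>" z]
    by (simp add: lookup_p is_subfield_0 is_subfield_1 is_subfield_minus)
  ultimately show ?thesis
    unfolding sigma_alg_dependent_def by blast
qed

end

section \<open>The multiplicative criterion for \<open>\<sigma>\<close>-algebraic dependence\<close>

theorem theorem3p1:
  fixes \<phi> \<sigma> :: "'a::field \<Rightarrow> 'a"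
    and \<iota> :: "ratfun \<Rightarrow> 'a"
    and a1 a2 b1 b2 :: complex
    and f :: 'a and a :: ratfun
  assumes "phi_sigma_field_over_ratfun \<phi> \<sigma> \<iota> a1 a2 b1 b2"
    and "f \<noteq> 0" and "a \<noteq> 0"
    and "\<phi> f = \<iota> a * f"
  shows "sigma_alg_dependent \<sigma> (adjoin (fixed_field \<phi>) (\<iota> rat_z)) f \<longleftrightarrow>
    (\<exists>(b :: ratfun) (t :: nat) (n :: nat \<Rightarrow> int).
       b \<noteq> 0 \<and> t \<ge> 1 \<and> (\<exists>i<t. n i \<noteq> 0) \<and>
       mult_fun \<sigma> t n (\<iota> a) = \<phi> (\<iota> b) / \<iota> b)"
proof -
  interpret phi_sigma_field_over_ratfun \<phi> \<sigma> \<iota> a1 a2 b1 b2 by fact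
  show ?thesis
    using multiplicative_relation_if_dependent[OF assms(2-4)]
      dependent_if_multiplicative_relation[OF assms(2,4)] by blast
qed

end
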